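(* The family $\{e_\gamma:\gamma\in\Gamma_1\}$ is a maximally orthogonal collection of exponentials for $L^2(X_{3/4},\nu_{3/4})$. In other words, it is a pairwise orthogonal collection, and given $x\in\mathbb{R}\setminus\Gamma_1$ there exists $\gamma\in\Gamma_1$ such that $e_x$ and $e_\gamma$ are not orthogonal in $L^2(X_{3/4},\nu_{3/4})$.
   Context: Let $\tau_+(x)=\frac34 x+1$ and $\tau_-(x)=\frac34 x-1$ on $\mathbb{R}$. The measure $\nu_{3/4}$ is the unique Borel probability measure on $\mathbb{R}$ satisfying $\nu_{3/4}=\frac12(\nu_{3/4}\circ\tau_+^{-1}+\nu_{3/4}\circ\tau_-^{-1})$, and $X_{3/4}$ is its support. For $\ell\in\mathbb{R}$, $e_\ell(x)=e^{2\pi i\ell x}$; orthogonality is with respect to the inner product $\langle f,g\rangle=\int f\,\overline{g}\,d\nu_{3/4}$, and a collection $\{e_\gamma:\gamma\in\Gamma\}$ is pairwise orthogonal if $\langle e_\gamma,e_{\gamma'}\rangle=0$ for all distinct $\gamma,\gamma'\in\Gamma$. The set $\Gamma_1$ is $$\Gamma_1=\left\{\sum_{j=0}^{p}\frac{a_j4^j}{3}\;:\;p\in\{0,1,2,\dots\},\ a_j\in\{0,1\}\right\}\cup\{0\}.$$ *)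

theory Defs
  imports "HOL-Probability.Probability"
begin

definition tau_plus :: "real \<Rightarrow> real" where
  "tau_plus x = 3 / 4 * x + 1"

definition tau_minus :: "real \<Rightarrow> real" where
  "tau_minus x = 3 / 4 * x - 1"

definition self_similar_measure :: "real measure \<Rightarrow> bool" where
  "self_similar_measure M \<longleftrightarrow>
     prob_space M \<and> sets M = sets borel \<and>
     (\<forall>A \<in> sets borel.
        measure M A = 1 / 2 * (measure M (tau_plus -` A) + measure M (tau_minus -` A)))"

text \<open>
  The description is proper: see \<open>ex1_self_similar_measure\<close> below.
\<close>

definition nu34 :: "real measure" where
  "nu34 = (THE M. self_similar_measure M)"

definition measure_support :: "'a::topological_space measure \<Rightarrow> 'a set" where
  "measure_support M = {x. \<forall>U. open U \<and> x \<in> U \<longrightarrow> emeasure M U > 0}"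

definition X34 :: "real set" where
  "X34 = measure_support nu34"

definition expo :: "real \<Rightarrow> real \<Rightarrow> complex" where
  "expo l x = exp (2 * of_real pi * \<i> * of_real l * of_real x)"

text \<open>
  The inner product of \<open>L\<^sup>2(X34, nu34)\<close>, on representatives. Since \<open>X34\<close> has full measure, it is
  also the integral over the whole line (\<open>L2_inner_eq\<close> below). The Bochner integral takes the value
  \<open>0\<close> on non-integrable functions, but exponentials are square-integrable
  (\<open>expo_square_integrable\<close> below), so this convention plays no role for them.
\<close>

definition L2_inner :: "(real \<Rightarrow> complex) \<Rightarrow> (real \<Rightarrow> complex) \<Rightarrow> complex" where
  "L2_inner f g = (LINT x:X34|nu34. f x * cnj (g x))"

definition Gamma1 :: "real set" where
  "Gamma1 = {\<Sum>j = 0..p. a j * 4 ^ j / 3 | (p :: nat) (a :: nat \<Rightarrow> real). \<forall>j. a j \<in> {0, 1}} \<union> {0}"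


section \<open>The measure is well defined\<close>

lemma tau_measurable [measurable]:
  "tau_plus \<in> borel_measurable borel" "tau_minus \<in> borel_measurable borel"
  unfolding tau_plus_def[abs_def] tau_minus_def[abs_def] by measurable

definition coin :: "bool measure" where
  "coin = measure_pmf (pmf_of_set UNIV)"

lemma prob_space_coin: "prob_space coin"
  unfolding coin_def by (rule prob_space_measure_pmf)

lemma space_coin [simp]: "space coin = UNIV"
  by (simp add: coin_def)

lemma sets_coin [measurable_cong]: "sets coin = sets (count_space UNIV)"
  by (simp add: coin_def)

lemma nn_integral_coin: "(\<integral>\<^sup>+b. f b \<partial>coin) = (f True + f False) / 2"
proof -
  have "(\<integral>\<^sup>+b. f b \<partial>coin) = sum f UNIV / of_nat (card (UNIV :: bool set))"
    unfolding coin_def by (subst nn_integral_pmf_of_set) auto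
  then show ?thesis by (simp add: UNIV_bool add.commute)
qed

definition tau :: "bool \<Rightarrow> real \<Rightarrow> real" where
  "tau b = (if b then tau_plus else tau_minus)"

lemma tau_pair_measurable:
  assumes "sets M = sets borel"
  shows "(\<lambda>(b, x). tau b x) \<in> measurable (coin \<Otimes>\<^sub>M M) borel"
proof -
  have "fst \<in> measurable (coin \<Otimes>\<^sub>M M) coin" by (rule measurable_fst)
  then have [measurable]: "Measurable.pred (coin \<Otimes>\<^sub>M M) fst"
    by (simp cong: measurable_cong_sets add: measurable_cong_sets[OF refl sets_coin])
  have "snd \<in> measurable (coin \<Otimes>\<^sub>M M) M" by (rule measurable_snd)
  then have [measurable]: "snd \<in> borel_measurable (coin \<Otimes>\<^sub>M M)"
    by (simp add: measurable_cong_sets[OF refl assms])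
  have "(\<lambda>(b, x). tau b x) = (\<lambda>z. 3 / 4 * snd z + (if fst z then 1 else - 1))"
    by (auto simp: tau_def tau_plus_def tau_minus_def)
  then show ?thesis by simp
qed

definition code :: "bool stream \<Rightarrow> real" where
  "code s = (\<Sum>k. (3 / 4) ^ k * (if s !! k then 1 else -1))"

lemma code_SCons: "code (b ## s) = tau b (code s)"
proof -
  have summ: "summable (\<lambda>k. (3 / 4) ^ k * (if s !! k then 1 else -1 :: real))" for s
    by (rule summable_comparison_test'[where g = "\<lambda>k. (3 / 4 :: real) ^ k" and N = 0])
       (auto simp: abs_mult)
  have "code (b ## s) = (if b then 1 else -1) +
      (\<Sum>k. (3 / 4) ^ Suc k * (if s !! k then 1 else -1))"
    unfolding code_def using suminf_split_head[OF summ[of "b ## s"]] by simp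
  also have "(\<Sum>k. (3 / 4) ^ Suc k * (if s !! k then 1 else -1)) = 3 / 4 * code s"
    unfolding code_def using suminf_mult[OF summ[of s], of "3 / 4"] by (simp add: mult.assoc)
  finally show ?thesis by (simp add: tau_def tau_plus_def tau_minus_def)
qed

lemma ex_self_similar_measure: "\<exists>M. self_similar_measure M"
proof -
  interpret C: prob_space coin by (rule prob_space_coin)
  let ?S = "stream_space coin"
  interpret S: prob_space ?S by (rule C.prob_space_stream_space)
  have code_meas [measurable]: "code \<in> borel_measurable ?S"
    unfolding code_def[abs_def] by measurable
  define M where "M = distr ?S borel code"
  interpret M: prob_space M unfolding M_def by (rule S.prob_space_distr) measurable
  have sets_M: "sets M = sets borel" by (simp add: M_def)
  have "measure M A = 1 / 2 * (measure M (tau_plus -` A) + measure M (tau_minus -` A))"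
    if A [measurable]: "A \<in> sets borel" for A
  proof -
    have vim: "tau b -` A \<in> sets borel" for b
      using measurable_sets[OF tau_measurable(1) A] measurable_sets[OF tau_measurable(2) A]
      by (simp add: tau_def)
    have em: "emeasure M B = (\<integral>\<^sup>+s. indicator B (code s) \<partial>?S)" if "B \<in> sets borel" for B
    proof -
      have "emeasure M B = (\<integral>\<^sup>+x. indicator B x \<partial>M)"
        using that by (simp add: sets_M)
      also have "\<dots> = (\<integral>\<^sup>+s. indicator B (code s) \<partial>?S)"
        unfolding M_def using that by (intro nn_integral_distr) auto
      finally show ?thesis .
    qed
    have "emeasure M A = (\<integral>\<^sup>+b. \<integral>\<^sup>+s. indicator A (code (b ## s)) \<partial>?S \<partial>coin)"
      unfolding em[OF A] by (intro C.nn_integral_stream_space) measurable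
    also have "\<dots> = (\<integral>\<^sup>+b. emeasure M (tau b -` A) \<partial>coin)"
      unfolding em[OF vim] by (simp add: code_SCons indicator_def)
    also have "\<dots> = (emeasure M (tau_plus -` A) + emeasure M (tau_minus -` A)) / 2"
      by (simp add: nn_integral_coin tau_def)
    finally have "ennreal (measure M A) =
        ennreal ((measure M (tau_plus -` A) + measure M (tau_minus -` A)) / 2)"
      unfolding M.emeasure_eq_measure
      by (simp add: divide_ennreal[symmetric] ennreal_plus[symmetric] del: ennreal_plus)
    then show ?thesis by simp
  qed
  then show ?thesis
    unfolding self_similar_measure_def using M.prob_space_axioms sets_M by blast
qed

lemma self_similar_measure_distr:
  assumes "self_similar_measure M"
  shows "M = distr (coin \<Otimes>\<^sub>M M) borel (\<lambda>(b, x). tau b x)"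
proof (rule measure_eqI)
  interpret M: prob_space M using assms by (simp add: self_similar_measure_def)
  have sM [measurable_cong]: "sets M = sets borel"
    using assms by (simp add: self_similar_measure_def)
  have spM: "space M = UNIV" using sets_eq_imp_space_eq[OF sM] by simp
  show "sets M = sets (distr (coin \<Otimes>\<^sub>M M) borel (\<lambda>(b, x). tau b x))" by (simp add: sM)
  fix A assume "A \<in> sets M"
  then have A [measurable]: "A \<in> sets borel" by (simp add: sM)
  have meas [measurable]: "(\<lambda>(b, x). tau b x) \<in> measurable (coin \<Otimes>\<^sub>M M) borel"
    by (rule tau_pair_measurable[OF sM])
  have "emeasure (distr (coin \<Otimes>\<^sub>M M) borel (\<lambda>(b, x). tau b x)) A =
      emeasure (coin \<Otimes>\<^sub>M M) ((\<lambda>(b, x). tau b x) -` A \<inter> space (coin \<Otimes>\<^sub>M M))"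
    by (rule emeasure_distr[OF meas A])
  also have "\<dots> = (\<integral>\<^sup>+b. emeasure M (tau b -` A) \<partial>coin)"
    by (subst M.emeasure_pair_measure_alt[OF measurable_sets[OF meas A]])
       (auto intro!: nn_integral_cong arg_cong[of _ _ "emeasure M"]
         simp: space_pair_measure spM)
  also have "\<dots> = (emeasure M (tau_plus -` A) + emeasure M (tau_minus -` A)) / 2"
    by (simp add: nn_integral_coin tau_def)
  also have "\<dots> = ennreal ((measure M (tau_plus -` A) + measure M (tau_minus -` A)) / 2)"
    unfolding M.emeasure_eq_measure
    by (simp add: divide_ennreal[symmetric] ennreal_plus[symmetric] del: ennreal_plus)
  also have "\<dots> = emeasure M A"
    unfolding M.emeasure_eq_measure using assms A by (simp add: self_similar_measure_def)
  finally show "emeasure M A = emeasure (distr (coin \<Otimes>\<^sub>M M) borel (\<lambda>(b, x). tau b x)) A" ..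
qed

lemma self_similar_measure_char:
  assumes "self_similar_measure M"
  shows "char M t = of_real (cos t) * char M (3 / 4 * t)"
proof -
  interpret M: prob_space M using assms by (simp add: self_similar_measure_def)
  interpret C: prob_space coin by (rule prob_space_coin)
  interpret P: pair_prob_space coin M ..
  have sM [measurable_cong]: "sets M = sets borel"
    using assms by (simp add: self_similar_measure_def)
  have meas [measurable]: "(\<lambda>(b, x). tau b x) \<in> measurable (coin \<Otimes>\<^sub>M M) borel"
    by (rule tau_pair_measurable[OF sM])
  have "char M t = (CLINT x|distr (coin \<Otimes>\<^sub>M M) borel (\<lambda>(b, x). tau b x). iexp (t * x))"
    unfolding char_def by (subst self_similar_measure_distr[OF assms]) simp
  also have "\<dots> = (CLINT z|coin \<Otimes>\<^sub>M M. iexp (t * (case z of (b, x) \<Rightarrow> tau b x)))"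
    by (rule integral_distr) measurable
  also have "\<dots> = (CLINT (b, x)|coin \<Otimes>\<^sub>M M. iexp (t * tau b x))"
    by (simp add: case_prod_unfold)
  also have "\<dots> = (CLINT b|coin. CLINT x|M. iexp (t * tau b x))"
  proof -
    have "integrable (coin \<Otimes>\<^sub>M M) (\<lambda>(b, x). iexp (t * tau b x))"
      using meas by (intro P.integrable_const_bound[where B = 1])
        (auto simp: case_prod_unfold)
    from P.integral_fst'[OF this] show ?thesis by simp
  qed
  also have "\<dots> = ((CLINT x|M. iexp (t * tau_plus x)) + (CLINT x|M. iexp (t * tau_minus x))) / 2"
    unfolding coin_def
    by (subst integral_measure_pmf[where A = UNIV])
       (auto simp: UNIV_bool tau_def scaleR_conv_of_real)
  also have "(CLINT x|M. iexp (t * tau_plus x)) = iexp t * char M (3 / 4 * t)"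
    unfolding char_def tau_plus_def integral_mult_right_zero[symmetric] exp_add[symmetric]
    by (simp add: algebra_simps)
  also have "(CLINT x|M. iexp (t * tau_minus x)) = iexp (- t) * char M (3 / 4 * t)"
    unfolding char_def tau_minus_def integral_mult_right_zero[symmetric] exp_add[symmetric]
    by (simp add: algebra_simps)
  also have "(iexp t * char M (3 / 4 * t) + iexp (- t) * char M (3 / 4 * t)) / 2 =
      of_real (cos t) * char M (3 / 4 * t)"
    by (simp add: cos_of_real[symmetric] cos_exp_eq algebra_simps add_divide_distrib)
  finally show ?thesis .
qed

lemma self_similar_measure_unique:
  assumes "self_similar_measure M" "self_similar_measure N"
  shows "M = N"
proof -
  interpret M: prob_space M using assms by (simp add: self_similar_measure_def)
  interpret N: prob_space N using assms by (simp add: self_similar_measure_def)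
  have M: "real_distribution M" and N: "real_distribution N"
    using assms unfolding self_similar_measure_def real_distribution_def
      real_distribution_axioms_def by auto
  have "char M t = char N t" for t
  proof -
    let ?d = "\<lambda>t. norm (char M t - char N t)"
    have step: "?d t \<le> ?d (3 / 4 * t)" for t
    proof -
      have "?d t = \<bar>cos t\<bar> * ?d (3 / 4 * t)"
        unfolding self_similar_measure_char[OF assms(1), of t]
          self_similar_measure_char[OF assms(2), of t]
        by (simp add: right_diff_distrib[symmetric] norm_mult)
      also have "\<dots> \<le> 1 * ?d (3 / 4 * t)"
        by (intro mult_right_mono) auto
      finally show ?thesis by simp
    qed
    have iter: "?d t \<le> ?d ((3 / 4) ^ n * t)" for n
    proof (induction n)
      case (Suc n)
      then show ?case using step[of "(3 / 4) ^ n * t"] by (simp add: mult.assoc)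
    qed simp
    have lim0: "(\<lambda>n. (3 / 4) ^ n * t) \<longlonglongrightarrow> 0"
      by (rule tendsto_mult_left_zero, rule LIMSEQ_power_zero) simp
    have "(\<lambda>n. char M ((3 / 4) ^ n * t)) \<longlonglongrightarrow> char M 0"
         "(\<lambda>n. char N ((3 / 4) ^ n * t)) \<longlonglongrightarrow> char N 0"
      using real_distribution.isCont_char[OF M] real_distribution.isCont_char[OF N] lim0
      by (auto intro: isCont_tendsto_compose)
    then have "(\<lambda>n. ?d ((3 / 4) ^ n * t)) \<longlonglongrightarrow> norm (char M 0 - char N 0)"
      by (intro tendsto_norm tendsto_diff)
    then have "?d t \<le> norm (char M 0 - char N 0)"
      using iter by (intro Lim_bounded2) auto
    then show ?thesis
      by (simp add: real_distribution.char_zero[OF M] real_distribution.char_zero[OF N])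
  qed
  then show ?thesis by (intro Levy_uniqueness M N) auto
qed

lemma ex1_self_similar_measure: "\<exists>!M. self_similar_measure M"
  using ex_self_similar_measure self_similar_measure_unique by blast

lemma self_similar_measure_nu34: "self_similar_measure nu34"
  unfolding nu34_def by (rule theI'[OF ex1_self_similar_measure])


section \<open>The space of square-integrable functions\<close>

lemma open_Compl_measure_support: "open (- measure_support M)"
proof (subst open_subopen, intro ballI)
  fix x assume "x \<in> - measure_support M"
  then obtain U where "open U" "x \<in> U" "emeasure M U = 0"
    by (auto simp: measure_support_def)
  then show "\<exists>T. open T \<and> x \<in> T \<and> T \<subseteq> - measure_support M"
    by (intro exI[of _ U]) (auto simp: measure_support_def)
qed

lemma AE_measure_support:
  fixes M :: "'a::second_countable_topology measure"
  assumes "sets M = sets borel"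
  shows "AE x in M. x \<in> measure_support M"
proof -
  define F where "F = {U :: 'a set. open U \<and> emeasure M U = 0}"
  obtain F' where F': "F' \<subseteq> F" "countable F'" "\<Union>F' = \<Union>F"
    using Lindelof[of F] by (auto simp: F_def)
  have "\<Union>F' \<in> null_sets M"
  proof -
    have "(\<Union>U\<in>F'. U) \<in> null_sets M"
      using F' by (intro null_sets_UN') (auto simp: F_def null_sets_def assms)
    then show ?thesis by simp
  qed
  moreover have "- measure_support M = \<Union>F'"
    unfolding F' F_def measure_support_def by (auto simp: zero_less_iff_neq_zero)
  ultimately show ?thesis
    by (intro AE_I'[of "\<Union>F'"]) auto
qed

lemma L2_inner_eq:
  assumes "f \<in> borel_measurable borel" "g \<in> borel_measurable borel"
  shows "L2_inner f g = (LINT x|nu34. f x * cnj (g x))"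
proof -
  have s [measurable_cong]: "sets nu34 = sets borel"
    using self_similar_measure_nu34 by (simp add: self_similar_measure_def)
  have [measurable]: "f \<in> borel_measurable nu34" "g \<in> borel_measurable nu34"
    using assms by (simp_all add: measurable_cong_sets[OF s refl])
  have "(\<lambda>x. cnj (g x)) \<in> borel_measurable nu34"
    by (rule measurable_compose[of g])
       (auto intro!: borel_measurable_continuous_onI continuous_intros)
  note [measurable] = this
  have [measurable]: "(\<lambda>x. f x * cnj (g x)) \<in> borel_measurable nu34"
    by (intro borel_measurable_times) measurable
  have "closed X34"
    using open_Compl_measure_support[of nu34] by (simp add: X34_def closed_def)
  then have [measurable]: "X34 \<in> sets nu34" by (simp add: s)
  have "AE x in nu34. x \<in> X34" unfolding X34_def by (rule AE_measure_support[OF s])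
  then show ?thesis
    unfolding L2_inner_def set_lebesgue_integral_def
    by (intro integral_cong_AE borel_measurable_scaleR borel_measurable_indicator) auto
qed

lemma expo_square_integrable:
  "expo l \<in> borel_measurable nu34" "integrable nu34 (\<lambda>x. (norm (expo l x))\<^sup>2)"
proof -
  interpret prob_space nu34
    using self_similar_measure_nu34 by (simp add: self_similar_measure_def)
  have s [measurable_cong]: "sets nu34 = sets borel"
    using self_similar_measure_nu34 by (simp add: self_similar_measure_def)
  have "continuous_on UNIV (expo l)"
    unfolding expo_def[abs_def] by (intro continuous_intros)
  then show "expo l \<in> borel_measurable nu34"
    by (simp add: borel_measurable_continuous_onI measurable_cong_sets[OF s refl])
  show "integrable nu34 (\<lambda>x. (norm (expo l x))\<^sup>2)"
    by (simp add: expo_def norm_exp_eq_Re)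
qed

end

theory Submission
  imports Defs
begin

text \<open>
  The inner product of \<open>e\<^sub>x\<close> and \<open>e\<^sub>\<gamma>\<close> is the characteristic function of the measure at
  \<open>2\<pi>(x - \<gamma>)\<close>. By self-similarity this is the infinite product of the factors
  \<open>cos (2\<pi> (3/4)\<^sup>k (x - \<gamma>))\<close>, and since the characteristic function is continuous and equal to 1
  at 0, the product vanishes only if one of its factors does. Hence \<open>e\<^sub>x\<close> and \<open>e\<^sub>\<gamma>\<close> are
  orthogonal iff \<open>s = 3(x - \<gamma>)\<close> satisfies \<open>4 \<cdot> 3\<^sup>k s = 3 \<cdot> 4\<^sup>k i\<close> for some \<open>k \<ge> 0\<close> and odd \<open>i\<close>
  (\<open>L2_inner_expo_eq_0_iff\<close>). For an integer \<open>s\<close> this says that \<open>s\<close> is an odd number times a power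
  of 4 (\<open>orth_diff_of_int_iff\<close>).

  The set \<open>3\<Gamma>\<^sub>1\<close> consists of the integers whose base-4 digits are all 0 or 1. The difference of
  two distinct such integers has its lowest nonzero digit equal to 1 or 3, that is, it is an odd number
  times a power of 4, which proves orthogonality.

  For maximality, let \<open>e\<^sub>x\<close> be orthogonal to all \<open>e\<^sub>\<gamma>\<close> and put \<open>y = 3x\<close>. Comparing the conditions for
  \<open>y\<close> and \<open>y - 1\<close>, of which at most one can be even 2-adically, forces \<open>y\<close> to be an integer
  (\<open>orth_diff_consecutive_imp_int\<close>). If \<open>y\<close> were 2 or 3 modulo 4, then \<open>y\<close> or \<open>y - 1\<close> would be
  2 modulo 4, hence not an odd number times a power of 4. So the last base-4 digit of \<open>y\<close> is 0 or 1;
  stripping it gives an integer of smaller absolute value with the same property, and the descent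
  ends at 0, which is not an odd number times a power of 4 (\<open>exists_base4_not_odd_times_pow4\<close>).
\<close>


section \<open>Orthogonality of two exponentials\<close>

lemma char_nu34_iterate:
  "char nu34 t = of_real (\<Prod>k<n. cos ((3 / 4) ^ k * t)) * char nu34 ((3 / 4) ^ n * t)"
proof (induction n)
  case (Suc n)
  show ?case
    using self_similar_measure_char[OF self_similar_measure_nu34, of "(3 / 4) ^ n * t"] Suc
    by (simp add: mult.assoc)
qed simp

lemma char_nu34_eq_0_iff: "char nu34 t = 0 \<longleftrightarrow> (\<exists>k. cos ((3 / 4) ^ k * t) = 0)"
proof
  interpret prob_space nu34
    using self_similar_measure_nu34 by (simp add: self_similar_measure_def)
  interpret real_distribution nu34
    using self_similar_measure_nu34
    by unfold_locales (simp add: self_similar_measure_def)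
  assume zero: "char nu34 t = 0"
  have "(\<lambda>n. (3 / 4) ^ n * t) \<longlonglongrightarrow> 0"
    by (rule tendsto_mult_left_zero, rule LIMSEQ_power_zero) simp
  then have "(\<lambda>n. char nu34 ((3 / 4) ^ n * t)) \<longlonglongrightarrow> char nu34 0"
    using isCont_char by (auto intro: isCont_tendsto_compose)
  then have "(\<lambda>n. char nu34 ((3 / 4) ^ n * t)) \<longlonglongrightarrow> 1"
    by (simp add: char_zero)
  then have "\<forall>\<^sub>F n in sequentially. char nu34 ((3 / 4) ^ n * t) \<noteq> 0"
    by (rule tendsto_imp_eventually_ne) simp
  then obtain n where "char nu34 ((3 / 4) ^ n * t) \<noteq> 0"
    by (auto simp: eventually_sequentially)
  with zero char_nu34_iterate[of t n] have "(\<Prod>k<n. cos ((3 / 4) ^ k * t)) = 0"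
    by (metis mult_eq_0_iff of_real_eq_0_iff)
  then show "\<exists>k. cos ((3 / 4) ^ k * t) = 0"
    by auto
next
  assume "\<exists>k. cos ((3 / 4) ^ k * t) = 0"
  then obtain k where "cos ((3 / 4) ^ k * t) = 0" ..
  then show "char nu34 t = 0"
    using char_nu34_iterate[of t "Suc k"] by simp
qed

lemma L2_inner_expo: "L2_inner (expo x) (expo y) = char nu34 (2 * pi * (x - y))"
proof -
  have meas: "expo l \<in> borel_measurable borel" for l
    unfolding expo_def[abs_def] by (intro borel_measurable_continuous_onI continuous_intros)
  have "cnj (expo y u) = exp (- (2 * of_real pi * \<i> * of_real y * of_real u))" for u
    by (simp add: expo_def exp_cnj)
  then have "expo x u * cnj (expo y u) = iexp (2 * pi * (x - y) * u)" for u
    unfolding expo_def[of x] by (simp only: mult_exp_exp) (simp add: algebra_simps)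
  then show ?thesis
    by (simp add: L2_inner_eq[OF meas meas] char_def)
qed

text \<open>
  The condition on \<open>s = 3(x - y)\<close> under which \<open>e\<^sub>x\<close> and \<open>e\<^sub>y\<close> are orthogonal. It is stated without
  fractions: \<open>s = (4/3)\<^sup>k \<cdot> 3i/4\<close> for some odd \<open>i\<close>.
\<close>

definition orth_diff :: "real \<Rightarrow> bool" where
  "orth_diff s \<longleftrightarrow> (\<exists>k (i :: int). odd i \<and> 4 * 3 ^ k * s = 3 * 4 ^ k * of_int i)"

lemma L2_inner_expo_eq_0_iff:
  "L2_inner (expo x) (expo y) = 0 \<longleftrightarrow> orth_diff (3 * (x - y))"
proof -
  have "(3 / 4) ^ k * (2 * pi * (x - y)) = of_int i * (pi / 2) \<longleftrightarrow>
      4 * 3 ^ k * (3 * (x - y)) = 3 * 4 ^ k * of_int i" for k i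
  proof -
    have "(3 / 4) ^ k * (2 * pi * (x - y)) = (3 / 4) ^ k * (x - y) * 4 * (pi / 2)"
      by (simp add: algebra_simps)
    then have "(3 / 4) ^ k * (2 * pi * (x - y)) = of_int i * (pi / 2) \<longleftrightarrow>
        (3 / 4) ^ k * (x - y) * 4 = of_int i"
      by (simp only: mult_cancel_right) simp
    also have "\<dots> \<longleftrightarrow> 4 * 3 ^ k * (x - y) = 4 ^ k * of_int i"
      by (simp add: field_simps)
    also have "\<dots> \<longleftrightarrow> 3 * (4 * 3 ^ k * (x - y)) = 3 * (4 ^ k * of_int i)"
      by (subst mult_cancel_left) simp
    also have "\<dots> \<longleftrightarrow> 4 * 3 ^ k * (3 * (x - y)) = 3 * 4 ^ k * of_int i"
      by (simp only: mult_ac)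
    finally show ?thesis .
  qed
  then show ?thesis
    unfolding L2_inner_expo char_nu34_eq_0_iff cos_zero_iff_int orth_diff_def by simp
qed


section \<open>Integers with even 2-adic valuation\<close>

text \<open>The nonzero integers with even 2-adic valuation.\<close>

definition odd_times_pow4 :: "int \<Rightarrow> bool" where
  "odd_times_pow4 n \<longleftrightarrow> (\<exists>j m. odd m \<and> n = 4 ^ j * m)"

lemma odd_times_pow4_odd: "odd n \<Longrightarrow> odd_times_pow4 n"
  unfolding odd_times_pow4_def by (intro exI[of _ 0] exI[of _ n]) simp

lemma odd_times_pow4_mult4: "odd_times_pow4 (4 * n) \<longleftrightarrow> odd_times_pow4 n"
proof
  assume "odd_times_pow4 n"
  then obtain j m where "odd m" "n = 4 ^ j * m"
    by (auto simp: odd_times_pow4_def)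
  then have "odd m \<and> 4 * n = 4 ^ Suc j * m"
    by simp
  then show "odd_times_pow4 (4 * n)"
    unfolding odd_times_pow4_def by blast
next
  assume "odd_times_pow4 (4 * n)"
  then obtain j m where m: "odd m" "4 * n = 4 ^ j * m"
    by (auto simp: odd_times_pow4_def)
  have "j \<noteq> 0"
  proof
    assume "j = 0"
    with m have "m = 4 * n" by simp
    with m(1) show False by simp
  qed
  then obtain j' where "j = Suc j'"
    using not0_implies_Suc by blast
  with m show "odd_times_pow4 n"
    by (auto simp: odd_times_pow4_def)
qed

lemma not_odd_times_pow4_0: "\<not> odd_times_pow4 0"
  by (auto simp: odd_times_pow4_def)

lemma not_odd_times_pow4_mod4:
  assumes "n mod 4 = 2"
  shows "\<not> odd_times_pow4 n"
proof
  assume "odd_times_pow4 n"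
  then obtain j m where m: "odd m" "n = 4 ^ j * m"
    by (auto simp: odd_times_pow4_def)
  show False
  proof (cases j)
    case 0
    with m have "odd n" by simp
    with assms show False by presburger
  next
    case (Suc j')
    with m assms show False by simp
  qed
qed

lemma orth_diff_of_int_iff: "orth_diff (of_int n) \<longleftrightarrow> odd_times_pow4 n"
proof
  assume "odd_times_pow4 n"
  then obtain j m where "odd m" "n = 4 ^ j * m"
    by (auto simp: odd_times_pow4_def)
  then have "odd (3 ^ j * m) \<and>
      4 * 3 ^ Suc j * real_of_int n = 3 * 4 ^ Suc j * real_of_int (3 ^ j * m)"
    by simp
  then show "orth_diff (of_int n)"
    unfolding orth_diff_def by blast
next
  assume "orth_diff (of_int n)"
  then obtain k i where i: "odd i" and "4 * 3 ^ k * real_of_int n = 3 * 4 ^ k * of_int i"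
    by (auto simp: orth_diff_def)
  then have "real_of_int (4 * 3 ^ k * n) = real_of_int (3 * 4 ^ k * i)"
    by simp
  then have eq: "4 * 3 ^ k * n = 3 * 4 ^ k * i"
    by (simp only: of_int_eq_iff)
  have "k \<noteq> 0"
  proof
    assume "k = 0"
    with eq have "4 * n = 3 * i" by simp
    with i show False by presburger
  qed
  then obtain a where "k = Suc a"
    using not0_implies_Suc by blast
  with eq have eq: "3 ^ a * n = 4 ^ a * i"
    by simp
  have "coprime (3 :: int) 4"
    by (simp add: coprime_iff_gcd_eq_1 gcd_non_0_int)
  then have "coprime (3 ^ a :: int) (4 ^ a)"
    by simp
  moreover have "3 ^ a dvd 4 ^ a * i"
    by (simp flip: eq)
  ultimately have "3 ^ a dvd i"
    by (simp add: coprime_dvd_mult_right_iff)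
  then obtain m where "i = 3 ^ a * m" ..
  with eq i have "odd m \<and> n = 4 ^ a * m"
    by auto
  then show "odd_times_pow4 n"
    unfolding odd_times_pow4_def by blast
qed

text \<open>
  A number satisfying \<open>orth_diff\<close> is an odd multiple of \<open>3/4\<close>, or it is an integer, or it is a
  fraction with odd denominator and even numerator. If \<open>y\<close> or \<open>y - 1\<close> were of the first kind, both
  would have denominator 4 and so both would be multiples of \<open>3/4\<close>, although they differ by 1. They
  cannot both be of the third kind either, because their numerators over a common odd denominator
  differ by that denominator.
\<close>

lemma orth_diff_consecutive_imp_int:
  assumes "orth_diff y" "orth_diff (y - 1)"
  shows "y \<in> \<int>"
proof -
  obtain k i where i: "odd i" and ki: "4 * 3 ^ k * y = 3 * 4 ^ k * of_int i"
    using assms(1) by (auto simp: orth_diff_def)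
  obtain l j where j: "odd j" and lj: "4 * 3 ^ l * (y - 1) = 3 * 4 ^ l * of_int j"
    using assms(2) by (auto simp: orth_diff_def)
  \<comment> \<open>Eliminating \<open>y\<close> leaves an equation between integers.\<close>
  have "real_of_int (4 * 3 ^ k * 3 ^ l) = of_int (3 * (3 ^ l * 4 ^ k * i - 3 ^ k * 4 ^ l * j))"
  proof -
    have "real_of_int (4 * 3 ^ k * 3 ^ l) =
        3 ^ l * (4 * 3 ^ k * y) - 3 ^ k * (4 * 3 ^ l * (y - 1))"
      by (simp add: algebra_simps)
    also have "\<dots> = of_int (3 * (3 ^ l * 4 ^ k * i - 3 ^ k * 4 ^ l * j))"
      unfolding ki lj by (simp add: algebra_simps)
    finally show ?thesis .
  qed
  then have eq: "4 * 3 ^ k * 3 ^ l = 3 * (3 ^ l * 4 ^ k * i - 3 ^ k * 4 ^ l * j)"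
    by (simp only: of_int_eq_iff)
  have kl: "k \<noteq> 0 \<and> l \<noteq> 0"
  proof (rule ccontr)
    assume *: "\<not> (k \<noteq> 0 \<and> l \<noteq> 0)"
    \<comment> \<open>By parity neither exponent can vanish alone, and modulo 3 they cannot vanish together.\<close>
    have "even (4 * 3 ^ k * 3 ^ l :: int)"
      by simp
    then have "even (3 * (3 ^ l * 4 ^ k * i - 3 ^ k * 4 ^ l * j))"
      by (simp only: eq)
    then have "even (3 ^ l * 4 ^ k * i - 3 ^ k * 4 ^ l * j)"
      by simp
    then have "k = 0 \<longleftrightarrow> l = 0"
      using i j by (cases "k = 0"; cases "l = 0"; simp)
    with * have "k = 0" "l = 0"
      by blast+
    with eq have "4 = 3 * (i - j)" by simp
    then show False by presburger
  qed
  obtain a where a: "k = Suc a" using kl not0_implies_Suc by blast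
  obtain b where b: "l = Suc b" using kl not0_implies_Suc by blast
  have "3 ^ a * 3 ^ b = 3 ^ b * 4 ^ a * i - 3 ^ a * 4 ^ b * j"
    using eq unfolding a b by (simp add: algebra_simps)
  moreover have "odd (3 ^ a * 3 ^ b :: int)"
    by simp
  ultimately have "odd (3 ^ b * 4 ^ a * i - 3 ^ a * 4 ^ b * j)"
    by simp
  then have "a = 0 \<or> b = 0"
    by auto
  then show ?thesis
  proof
    assume "a = 0"
    with a ki have "y = of_int i" by simp
    then show ?thesis by simp
  next
    assume "b = 0"
    with b lj have "y = of_int (j + 1)" by simp
    then show ?thesis by (metis Ints_of_int)
  qed
qed


section \<open>Integers with base-4 digits 0 and 1\<close>

text \<open>The integers whose base-4 digits are all 0 or 1, generated by appending a last digit.\<close>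

inductive_set base4 :: "int set" where
  zero: "0 \<in> base4"
| digit0: "n \<in> base4 \<Longrightarrow> 4 * n \<in> base4"
| digit1: "n \<in> base4 \<Longrightarrow> 4 * n + 1 \<in> base4"

lemma digit_sum_in_base4:
  assumes "\<forall>j. a j \<in> {0, 1}"
  shows "\<exists>n\<in>base4. (\<Sum>j = 0..p. a j * 4 ^ j / 3) = real_of_int n / 3"
  using assms
proof (induction p arbitrary: a)
  case 0
  have "1 \<in> base4" using base4.digit1[OF base4.zero] by simp
  moreover have "a 0 = 0 \<or> a 0 = 1" using 0 by simp
  ultimately show ?case using base4.zero by force
next
  case (Suc p)
  obtain n where n: "n \<in> base4" "(\<Sum>j = 0..p. a (Suc j) * 4 ^ j / 3) = real_of_int n / 3"
    using Suc.IH[of "\<lambda>j. a (Suc j)"] Suc.prems by auto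
  have "(\<Sum>j = 0..Suc p. a j * 4 ^ j / 3) =
      a 0 / 3 + 4 * (\<Sum>j = 0..p. a (Suc j) * 4 ^ j / 3)"
    by (simp add: sum.atLeast0_atMost_Suc_shift sum_distrib_left mult.left_commute del: sum.cl_ivl_Suc)
  also have "\<dots> = (4 * real_of_int n + a 0) / 3"
    using n by simp
  finally have *: "(\<Sum>j = 0..Suc p. a j * 4 ^ j / 3) = (4 * real_of_int n + a 0) / 3" .
  have "a 0 \<in> {0, 1}" using Suc.prems by blast
  then consider "a 0 = 0" | "a 0 = 1" by blast
  then show ?case
  proof cases
    case 1
    with * show ?thesis by (intro bexI[OF _ base4.digit0[OF n(1)]]) simp
  next
    case 2
    with * show ?thesis by (intro bexI[OF _ base4.digit1[OF n(1)]]) simp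
  qed
qed

lemma append_digit_in_Gamma1:
  assumes "x \<in> Gamma1" "d \<in> {0, 1}"
  shows "4 * x + d / 3 \<in> Gamma1"
proof -
  have "\<exists>p a. (\<forall>j. a j \<in> {0, 1}) \<and> x = (\<Sum>j = 0..p. a j * 4 ^ j / 3)"
  proof (cases "x = 0")
    case True
    then show ?thesis by (intro exI[of _ 0] exI[of _ "\<lambda>_. 0"]) simp
  next
    case False
    then show ?thesis using assms(1) unfolding Gamma1_def by blast
  qed
  then obtain p a where a: "\<forall>j. a j \<in> {0, 1}" "x = (\<Sum>j = 0..p. a j * 4 ^ j / 3)"
    by blast
  define a' where "a' = case_nat d a"
  have "\<forall>j. a' j \<in> {0, 1}"
    using a(1) assms(2) by (auto simp: a'_def split: nat.split)
  moreover have "4 * x + d / 3 = (\<Sum>j = 0..Suc p. a' j * 4 ^ j / 3)"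
    by (simp add: a(2) a'_def sum.atLeast0_atMost_Suc_shift sum_distrib_left mult.left_commute
        del: sum.cl_ivl_Suc)
  ultimately show ?thesis
    unfolding Gamma1_def by blast
qed

lemma Gamma1_eq: "Gamma1 = (\<lambda>n. real_of_int n / 3) ` base4"
proof
  show "Gamma1 \<subseteq> (\<lambda>n. real_of_int n / 3) ` base4"
    unfolding Gamma1_def using digit_sum_in_base4 base4.zero by (force simp: image_iff)
  have "real_of_int n / 3 \<in> Gamma1" if "n \<in> base4" for n
    using that
  proof induction
    case zero
    show ?case by (simp add: Gamma1_def)
  next
    case (digit0 n)
    then show ?case using append_digit_in_Gamma1[of "n / 3" 0] by simp
  next
    case (digit1 n)
    then show ?case using append_digit_in_Gamma1[of "n / 3" 1] by (simp add: add_divide_distrib)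
  qed
  then show "(\<lambda>n. real_of_int n / 3) ` base4 \<subseteq> Gamma1" by blast
qed

lemma odd_times_pow4_diff_base4:
  assumes "g \<in> base4" "h \<in> base4" "g \<noteq> h"
  shows "odd_times_pow4 (g - h)"
  using assms
proof (induction "nat (\<bar>g\<bar> + \<bar>h\<bar>)" arbitrary: g h rule: less_induct)
  case less
  have last_digit: "\<exists>n'\<in>base4. \<exists>d\<in>{0, 1}. n = 4 * n' + d" if "n \<in> base4" for n
    using that by cases (use base4.zero in force)+
  obtain g' d where g: "g' \<in> base4" "d \<in> {0, 1}" "g = 4 * g' + d"
    using last_digit[OF less.prems(1)] by blast
  obtain h' e where h: "h' \<in> base4" "e \<in> {0, 1}" "h = 4 * h' + e"
    using last_digit[OF less.prems(2)] by blast
  show ?case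
  proof (cases "d = e")
    case True
    with g h less.prems have "g' \<noteq> h'" by blast
    moreover have "nat (\<bar>g'\<bar> + \<bar>h'\<bar>) < nat (\<bar>g\<bar> + \<bar>h\<bar>)"
      using g h \<open>g' \<noteq> h'\<close> by auto
    ultimately have "odd_times_pow4 (g' - h')"
      using less.hyps g(1) h(1) by blast
    moreover have "g - h = 4 * (g' - h')"
      using True g h by simp
    ultimately show ?thesis
      by (simp only: odd_times_pow4_mult4)
  next
    case False
    then have "odd (g - h)" using g h by auto
    then show ?thesis by (rule odd_times_pow4_odd)
  qed
qed

lemma exists_base4_not_odd_times_pow4:
  "\<exists>g\<in>base4. \<not> odd_times_pow4 (y - g)"
proof (induction "nat \<bar>y\<bar>" arbitrary: y rule: less_induct)
  case less
  have one: "1 \<in> base4" using base4.digit1[OF base4.zero] by simp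
  consider "y = 0" | "y mod 4 = 2" | "y mod 4 = 3"
    | "y \<noteq> 0" "y mod 4 \<in> {0, 1}"
  proof -
    have "y mod 4 \<in> {0, 1} \<or> y mod 4 = 2 \<or> y mod 4 = 3" by simp presburger
    with that show ?thesis by blast
  qed
  then show ?case
  proof cases
    case 1
    then show ?thesis using base4.zero not_odd_times_pow4_0 by force
  next
    case 2
    then show ?thesis using base4.zero not_odd_times_pow4_mod4[of y] by force
  next
    case 3
    then have "(y - 1) mod 4 = 2" by presburger
    then show ?thesis using one not_odd_times_pow4_mod4 by blast
  next
    case 4
    define y' where "y' = y div 4"
    define d where "d = y mod 4"
    have d: "d = 0 \<or> d = 1" using 4(2) by (simp add: d_def)
    have y: "y = 4 * y' + d" by (simp add: y'_def d_def)
    have "nat \<bar>y'\<bar> < nat \<bar>y\<bar>" using y d 4(1) by linarith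
    then obtain g where g: "g \<in> base4" "\<not> odd_times_pow4 (y' - g)"
      using less.hyps by blast
    have "4 * g + d \<in> base4"
      using g(1) d base4.digit0[of g] base4.digit1[of g] by auto
    moreover have "y - (4 * g + d) = 4 * (y' - g)"
      using y by simp
    ultimately show ?thesis
      using g(2) odd_times_pow4_mult4 by metis
  qed
qed


section \<open>Maximal orthogonality\<close>

theorem theorem3p6:
  shows "(\<forall>\<gamma> \<in> Gamma1. \<forall>\<gamma>' \<in> Gamma1. \<gamma> \<noteq> \<gamma>' \<longrightarrow> L2_inner (expo \<gamma>) (expo \<gamma>') = 0) \<and>
    (\<forall>x :: real. x \<notin> Gamma1 \<longrightarrow> (\<exists>\<gamma> \<in> Gamma1. L2_inner (expo x) (expo \<gamma>) \<noteq> 0))"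
proof (intro conjI ballI allI impI)
  fix \<gamma> \<gamma>' assume "\<gamma> \<in> Gamma1" "\<gamma>' \<in> Gamma1" "\<gamma> \<noteq> \<gamma>'"
  then obtain g h where gh: "g \<in> base4" "h \<in> base4" "g \<noteq> h"
    and \<gamma>: "\<gamma> = of_int g / 3" "\<gamma>' = of_int h / 3"
    unfolding Gamma1_eq by blast
  have "3 * (\<gamma> - \<gamma>') = of_int (g - h)"
    by (simp add: \<gamma> algebra_simps)
  then show "L2_inner (expo \<gamma>) (expo \<gamma>') = 0"
    using odd_times_pow4_diff_base4[OF gh]
    by (simp only: L2_inner_expo_eq_0_iff orth_diff_of_int_iff)
next
  fix x :: real assume "x \<notin> Gamma1"
  show "\<exists>\<gamma> \<in> Gamma1. L2_inner (expo x) (expo \<gamma>) \<noteq> 0"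
  proof (rule ccontr)
    assume "\<not> ?thesis"
    then have *: "orth_diff (3 * x - of_int g)" if "g \<in> base4" for g
      using that unfolding Gamma1_eq L2_inner_expo_eq_0_iff by (simp add: right_diff_distrib)
    have "1 \<in> base4" using base4.digit1[OF base4.zero] by simp
    then have "3 * x \<in> \<int>"
      using *[OF base4.zero] *[of 1] by (intro orth_diff_consecutive_imp_int) simp_all
    then obtain y where y: "3 * x = of_int y"
      by (rule Ints_cases)
    obtain g where g: "g \<in> base4" "\<not> odd_times_pow4 (y - g)"
      using exists_base4_not_odd_times_pow4 by blast
    have "orth_diff (of_int (y - g))"
      using *[OF g(1)] y by simp
    with g(2) show False
      by (simp only: orth_diff_of_int_iff)
  qed
qed

end
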